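(* If $S$ is a topological monoid with open shifts, then $\mathcal{C}_3(S)=S_{sr}$; that is, $S_{sr}$ together with the identity map $S\to S_{sr}$ is the $T_3$-reflection of the space $S$.
   Context: A topological monoid is a monoid $S$ with a topology (no separation axiom assumed) for which the operation $S\times S\to S$ is continuous. It has open shifts if for every $a\in S$ and every open $U\subseteq S$ the sets $aU$ and $Ua$ are open in $S$. For a topological space $X$, an open set $U$ is regular open if $\mathrm{Int}(\overline{U})=U$; the regular open sets form a base of a topology on the set $X$, and $X_{sr}$ (the semiregularization) denotes $X$ with this topology. A space is $T_3$ if every point and every closed set not containing it have disjoint open neighborhoods ($T_1$ is not assumed). The class $\mathcal{C}_3$ of $T_3$ spaces is epireflective in the category of topological spaces: for each space $X$ there is a $T_3$ space $\mathcal{C}_3(X)$ and a continuous surjection $\varphi\colon X\to\mathcal{C}_3(X)$ such that every continuous map $f\colon X\to Y$ with $Y$ a $T_3$ space factors as $f=g\circ\varphi$ for a unique continuous $g$. The pair is unique up to canonical homeomorphism and is called the $T_3$-reflection of $X$; equality is understood in this sense. *)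

theory Defs
  imports "HOL-Analysis.Analysis" "HOL-Algebra.Coset"
begin

definition topological_monoid :: "('a, 'm) monoid_scheme \<Rightarrow> 'a topology \<Rightarrow> bool" where
  "topological_monoid S X \<longleftrightarrow>
     monoid S \<and> topspace X = carrier S \<and>
     continuous_map (prod_topology X X) X (\<lambda>(x, y). x \<otimes>\<^bsub>S\<^esub> y)"

definition open_shifts :: "('a, 'm) monoid_scheme \<Rightarrow> 'a topology \<Rightarrow> bool" where
  "open_shifts S X \<longleftrightarrow>
     (\<forall>a \<in> carrier S. \<forall>U. openin X U \<longrightarrow>
        openin X (a <#\<^bsub>S\<^esub> U) \<and> openin X (U #>\<^bsub>S\<^esub> a))"

definition regular_openin :: "'a topology \<Rightarrow> 'a set \<Rightarrow> bool" where
  "regular_openin X U \<longleftrightarrow> openin X U \<and> X interior_of (X closure_of U) = U"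

definition semiregularization :: "'a topology \<Rightarrow> 'a topology" where
  "semiregularization X = topology (arbitrary union_of regular_openin X)"

lemma regular_openin_Int:
  assumes "regular_openin X U" and "regular_openin X V"
  shows "regular_openin X (U \<inter> V)"
proof -
  have o: "openin X (U \<inter> V)"
    using assms by (simp add: regular_openin_def openin_Int)
  have "X interior_of (X closure_of (U \<inter> V)) \<subseteq> X interior_of (X closure_of U)"
    "X interior_of (X closure_of (U \<inter> V)) \<subseteq> X interior_of (X closure_of V)"
    by (simp_all add: closure_of_mono interior_of_mono)
  moreover have "U \<inter> V \<subseteq> X interior_of (X closure_of (U \<inter> V))"
    using o by (simp add: interior_of_maximal closure_of_subset openin_subset)
  ultimately show ?thesis
    using assms o unfolding regular_openin_def by blast
qed

lemma regular_openin_topspace: "regular_openin X (topspace X)"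
  by (simp add: regular_openin_def)

text \<open>The regular open sets really form a base, so the use of \<^const>\<open>topology\<close> above is legitimate.\<close>

lemma openin_semiregularization:
  "openin (semiregularization X) = arbitrary union_of regular_openin X"
  unfolding semiregularization_def
  by (intro topology_inverse' istopology_base regular_openin_Int)

lemma topspace_semiregularization [simp]: "topspace (semiregularization X) = topspace X"
proof
  have "\<And>U. regular_openin X U \<Longrightarrow> U \<subseteq> topspace X"
    by (simp add: regular_openin_def openin_subset)
  then show "topspace (semiregularization X) \<subseteq> topspace X"
    using openin_topspace[of "semiregularization X"]
    unfolding openin_semiregularization union_of_def by blast
  show "topspace X \<subseteq> topspace (semiregularization X)"
    by (rule openin_subset)
      (simp add: openin_semiregularization arbitrary_union_of_inc regular_openin_topspace)
qed

text \<open>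
  A \<open>T\<^sub>3\<close> space, with \<open>T\<^sub>1\<close> not assumed, is a \<^const>\<open>regular_space\<close>.
  HOL cannot quantify over types inside a formula, so the type \<open>'b\<close> on which the test spaces \<open>Y\<close>
  live is a parameter; \<open>(R, \<phi>)\<close> is the \<open>T\<^sub>3\<close>-reflection of \<open>X\<close> when the predicate holds for every
  type \<open>'b\<close>. As HOL functions are total, the factor \<open>g\<close> is unique only up to its values outside
  \<open>topspace R\<close>; these are normalised by \<^const>\<open>extensional\<close>.
\<close>

definition T3_reflection ::
  "'b itself \<Rightarrow> 'a topology \<Rightarrow> 'c topology \<Rightarrow> ('a \<Rightarrow> 'c) \<Rightarrow> bool" where
  "T3_reflection (_ :: 'b itself) X R \<phi> \<longleftrightarrow>
     regular_space R \<and>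
     continuous_map X R \<phi> \<and> \<phi> ` topspace X = topspace R \<and>
     (\<forall>(Y :: 'b topology) f. regular_space Y \<and> continuous_map X Y f \<longrightarrow>
        (\<exists>!g. g \<in> extensional (topspace R) \<and> continuous_map R Y g \<and>
              (\<forall>x \<in> topspace X. f x = g (\<phi> x))))"

end

theory Submission
  imports Defs
begin

text \<open>
  Let \<open>U\<close> be a regular open neighbourhood of \<open>x\<close>. Continuity of the product at \<open>(x, 1)\<close> gives open
  \<open>V \<ni> x\<close> and \<open>W \<ni> 1\<close> with \<open>V W \<subseteq> U\<close>. If \<open>y\<close> lies in the closure of \<open>V\<close>, then \<open>y W\<close> is an open
  neighbourhood of \<open>y\<close> contained in the closure of \<open>V W\<close>, so \<open>y\<close> is interior to the closure of \<open>U\<close>,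
  that is, \<open>y \<in> U\<close>. Hence the semiregularization is regular. Conversely, a continuous map \<open>f\<close> into
  any regular space stays continuous on the semiregularization: if the closure of \<open>W\<close> lies in \<open>V\<close>,
  the regular open hull of the preimage of \<open>W\<close> is mapped into \<open>V\<close>.
\<close>

text \<open>Interior of closure is idempotent: the closed set \<open>X closure_of U\<close> already
  contains the closure of its own interior. Every regular open set built below has this
  form.\<close>

lemma regular_openin_interior_of_closure_of:
  "regular_openin X (X interior_of (X closure_of U))"
proof -
  have "X closure_of (X interior_of (X closure_of U)) \<subseteq> X closure_of U"
    by (simp add: closure_of_minimal interior_of_subset)
  then have "X interior_of (X closure_of (X interior_of (X closure_of U))) \<subseteq> X interior_of (X closure_of U)"
    by (rule interior_of_mono)
  moreover have "X interior_of (X closure_of U) \<subseteq> X interior_of (X closure_of (X interior_of (X closure_of U)))"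
    by (simp add: closure_of_subset interior_of_maximal interior_of_subset_topspace)
  ultimately show ?thesis
    by (simp add: regular_openin_def)
qed

lemma openin_semiregularization_iff:
  "openin (semiregularization X) U \<longleftrightarrow>
     (\<forall>x \<in> U. \<exists>V. regular_openin X V \<and> x \<in> V \<and> V \<subseteq> U)"
  by (simp add: openin_semiregularization arbitrary_union_of_alt)

lemma regular_openin_imp_openin_semiregularization:
  "regular_openin X U \<Longrightarrow> openin (semiregularization X) U"
  by (auto simp: openin_semiregularization_iff)

text \<open>Regular open sets are open in \<open>X\<close>, so the semiregularization is a coarser
  topology on the same points.\<close>

lemma continuous_map_id_semiregularization:
  "continuous_map X (semiregularization X) id"
proof -
  have "openin X U" if "openin (semiregularization X) U" for U
    using that by (subst openin_subopen) (metis openin_semiregularization_iff regular_openin_def)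
  moreover have "{x \<in> topspace X. x \<in> U} = U" if "openin (semiregularization X) U" for U
    using openin_subset[OF that] by auto
  ultimately show ?thesis
    by (simp add: continuous_map)
qed

lemma closedin_semiregularization_closure_of:
  assumes "openin X U"
  shows "closedin (semiregularization X) (X closure_of U)"
proof -
  \<comment> \<open>The complement of the open set \<open>U\<close> is its own closure, and its
    interior is the complement of the closure of \<open>U\<close>.\<close>
  have "topspace X - X closure_of U = X interior_of (X closure_of (topspace X - U))"
    using assms by (simp add: closure_of_complement interior_of_complement interior_of_openin)
  then have "regular_openin X (topspace X - X closure_of U)"
    by (simp add: regular_openin_interior_of_closure_of)
  then show ?thesis
    by (simp add: closedin_def closure_of_subset_topspace regular_openin_imp_openin_semiregularization)
qed

text \<open>The hypothesis provides only an open \<open>V\<close> of \<open>X\<close>. Its regular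
  open hull \<open>X interior_of (X closure_of V)\<close> contains \<open>V\<close> and stays inside
  \<open>X closure_of V\<close>, which is closed in the coarser topology as well.\<close>

lemma regular_space_semiregularization:
  assumes *: "\<And>U x. regular_openin X U \<Longrightarrow> x \<in> U \<Longrightarrow>
     \<exists>V. openin X V \<and> x \<in> V \<and> X closure_of V \<subseteq> U"
  shows "regular_space (semiregularization X)"
  unfolding neighbourhood_base_of_closedin[symmetric] neighbourhood_base_of
proof (intro allI impI)
  fix U x assume "openin (semiregularization X) U \<and> x \<in> U"
  then obtain R where R: "regular_openin X R" "x \<in> R" "R \<subseteq> U"
    by (meson openin_semiregularization_iff)
  then obtain V where V: "openin X V" "x \<in> V" "X closure_of V \<subseteq> R"
    using * by blast
  show "\<exists>A B. openin (semiregularization X) A \<and> closedin (semiregularization X) B \<and>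
          x \<in> A \<and> A \<subseteq> B \<and> B \<subseteq> U"
  proof (intro exI conjI)
    show "openin (semiregularization X) (X interior_of (X closure_of V))"
      by (intro regular_openin_imp_openin_semiregularization regular_openin_interior_of_closure_of)
    show "closedin (semiregularization X) (X closure_of V)"
      by (simp add: V closedin_semiregularization_closure_of)
    show "x \<in> X interior_of (X closure_of V)"
      using V by (meson closure_of_subset interior_of_maximal openin_subset subsetD)
    show "X interior_of (X closure_of V) \<subseteq> X closure_of V"
      by (rule interior_of_subset)
    show "X closure_of V \<subseteq> U"
      using V R by blast
  qed
qed

lemma continuous_map_from_semiregularization:
  assumes Y: "regular_space Y" and f: "continuous_map X Y f"
  shows "continuous_map (semiregularization X) Y f"
  unfolding continuous_map
proof (intro conjI allI impI)
  show "f ` topspace (semiregularization X) \<subseteq> topspace Y"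
    using f by (simp add: continuous_map_image_subset_topspace)
  fix V assume V: "openin Y V"
  show "openin (semiregularization X) {x \<in> topspace (semiregularization X). f x \<in> V}"
    unfolding openin_semiregularization_iff
  proof
    fix x assume "x \<in> {x \<in> topspace (semiregularization X). f x \<in> V}"
    then have x: "x \<in> topspace X" "f x \<in> V"
      by auto
    then obtain W C where W: "openin Y W" "f x \<in> W" and C: "closedin Y C" "W \<subseteq> C" "C \<subseteq> V"
      using Y V unfolding neighbourhood_base_of_closedin[symmetric] neighbourhood_base_of
      by meson
    let ?P = "{x \<in> topspace X. f x \<in> W}"
    have P: "openin X ?P"
      using f W(1) by (rule openin_continuous_map_preimage)
    \<comment> \<open>The preimage of the closed set \<open>C\<close> is closed in \<open>X\<close>
      and contains \<open>?P\<close>.\<close>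
    have "X closure_of ?P \<subseteq> {x \<in> topspace X. f x \<in> C}"
      using closedin_continuous_map_preimage[OF f \<open>closedin Y C\<close>] C
      by (intro closure_of_minimal) auto
    then have "X interior_of (X closure_of ?P) \<subseteq> {x \<in> topspace X. f x \<in> V}"
      using interior_of_subset[of X "X closure_of ?P"] C by blast
    moreover have "?P \<subseteq> X interior_of (X closure_of ?P)"
      using P by (simp add: closure_of_subset interior_of_maximal)
    ultimately show "\<exists>U. regular_openin X U \<and> x \<in> U \<and>
        U \<subseteq> {x \<in> topspace (semiregularization X). f x \<in> V}"
      using x W regular_openin_interior_of_closure_of[of X ?P] by auto
  qed
qed

lemma T3_reflection_semiregularization:
  assumes "regular_space (semiregularization X)"
  shows "T3_reflection TYPE('b) X (semiregularization X) id"
  unfolding T3_reflection_def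
proof (intro conjI allI impI)
  fix Y :: "'b topology" and f
  assume "regular_space Y \<and> continuous_map X Y f"
  then have "continuous_map (semiregularization X) Y f"
    by (blast intro: continuous_map_from_semiregularization)
  \<comment> \<open>With \<open>id\<close> as reflection map, the factor must agree with
    \<open>f\<close> on \<open>topspace X\<close>; restricting makes it extensional, hence
    unique.\<close>
  then have "continuous_map (semiregularization X) Y (restrict f (topspace X))"
    by (rule continuous_map_eq) simp
  then show "\<exists>!g. g \<in> extensional (topspace (semiregularization X)) \<and>
      continuous_map (semiregularization X) Y g \<and> (\<forall>x \<in> topspace X. f x = g (id x))"
  proof (intro ex1I[of _ "restrict f (topspace X)"])
    fix g
    assume g: "g \<in> extensional (topspace (semiregularization X)) \<and>
      continuous_map (semiregularization X) Y g \<and> (\<forall>x \<in> topspace X. f x = g (id x))"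
    show "g = restrict f (topspace X)"
      by (rule extensionalityI[of _ "topspace X"]) (use g in simp_all)
  qed simp
qed (use assms continuous_map_id_semiregularization in auto)

lemma closure_of_subset_regular_openin:
  assumes S: "topological_monoid S X"
    and shifts: "\<And>a W. a \<in> carrier S \<Longrightarrow> openin X W \<Longrightarrow> openin X (a <#\<^bsub>S\<^esub> W)"
    and U: "regular_openin X U" and x: "x \<in> U"
  shows "\<exists>V. openin X V \<and> x \<in> V \<and> X closure_of V \<subseteq> U"
proof -
  interpret monoid S
    using S by (simp add: topological_monoid_def)
  have carrier: "topspace X = carrier S"
    and mult: "continuous_map (prod_topology X X) X (\<lambda>(x, y). x \<otimes>\<^bsub>S\<^esub> y)"
    using S by (simp_all add: topological_monoid_def)
  have "openin X U"
    using U by (simp add: regular_openin_def)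
  then have xc: "x \<in> carrier S"
    using x openin_subset carrier by blast
  \<comment> \<open>The preimage of \<open>U\<close> under multiplication contains
    \<open>(x, \<one>)\<close> because \<open>x\<close> times the unit is \<open>x\<close>; an open
    box around that point gives \<open>V\<close> and \<open>W\<close>.\<close>
  define P where "P = {z \<in> topspace (prod_topology X X). (\<lambda>(x, y). x \<otimes>\<^bsub>S\<^esub> y) z \<in> U}"
  have "openin (prod_topology X X) P"
    unfolding P_def by (rule openin_continuous_map_preimage[OF mult \<open>openin X U\<close>])
  moreover have "(x, \<one>\<^bsub>S\<^esub>) \<in> P"
    using x xc carrier by (simp add: P_def)
  ultimately have "\<exists>V W. openin X V \<and> openin X W \<and> x \<in> V \<and> \<one>\<^bsub>S\<^esub> \<in> W \<and> V \<times> W \<subseteq> P"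
    by (simp only: openin_prod_topology_alt)
  then obtain V W where V: "openin X V" "x \<in> V" and W: "openin X W" "\<one>\<^bsub>S\<^esub> \<in> W"
    and P: "V \<times> W \<subseteq> P"
    by blast
  have VW: "v \<otimes>\<^bsub>S\<^esub> w \<in> U" if "v \<in> V" "w \<in> W" for v w
    using subsetD[OF P SigmaI[OF that]] by (simp add: P_def)
  have "X closure_of V \<subseteq> U"
  proof
    fix y assume y: "y \<in> X closure_of V"
    then have yc: "y \<in> carrier S"
      unfolding carrier[symmetric] by (rule subsetD[OF closure_of_subset_topspace])
    \<comment> \<open>For fixed \<open>w\<close>, right translation by \<open>w\<close> is
      continuous and maps \<open>V\<close> into \<open>U\<close>, so it maps the closure of
      \<open>V\<close> into the closure of \<open>U\<close>.\<close>
    have "y \<otimes>\<^bsub>S\<^esub> w \<in> X closure_of U" if "w \<in> W" for w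
    proof -
      have wc: "w \<in> topspace X"
        using W that openin_subset by blast
      then have "continuous_map X (prod_topology X X) (\<lambda>v. (v, w))"
        by (simp add: continuous_map_pairedI)
      then have "continuous_map X X ((\<lambda>(x, y). x \<otimes>\<^bsub>S\<^esub> y) \<circ> (\<lambda>v. (v, w)))"
        using mult by (rule continuous_map_compose)
      then have "continuous_map X X (\<lambda>v. v \<otimes>\<^bsub>S\<^esub> w)"
        by (simp add: comp_def)
      then have "(\<lambda>v. v \<otimes>\<^bsub>S\<^esub> w) ` (X closure_of V) \<subseteq> X closure_of ((\<lambda>v. v \<otimes>\<^bsub>S\<^esub> w) ` V)"
        by (rule continuous_map_image_closure_subset)
      also have "\<dots> \<subseteq> X closure_of U"
        using VW that by (intro closure_of_mono image_subsetI)
      finally show ?thesis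
        using y by (rule subsetD[OF _ imageI])
    qed
    then have "y <#\<^bsub>S\<^esub> W \<subseteq> X closure_of U"
      by (auto simp: l_coset_def)
    then have "y <#\<^bsub>S\<^esub> W \<subseteq> X interior_of (X closure_of U)"
      using shifts yc W by (simp add: interior_of_maximal)
    \<comment> \<open>The unit lies in \<open>W\<close>, so \<open>y\<close> belongs to its own
      shift of \<open>W\<close>, which is open by \<open>shifts\<close>.\<close>
    moreover have "y \<in> y <#\<^bsub>S\<^esub> W"
      using W yc by (force simp: l_coset_def)
    ultimately show "y \<in> U"
      using U by (auto simp: regular_openin_def)
  qed
  with V show ?thesis
    by blast
qed

theorem corollary2p7:
  fixes S :: "('a, 'm) monoid_scheme" and X :: "'a topology"
  assumes "topological_monoid S X" and "open_shifts S X"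
  shows "T3_reflection TYPE('b) X (semiregularization X) id"
proof (intro T3_reflection_semiregularization regular_space_semiregularization)
  fix U x assume "regular_openin X U" "x \<in> U"
  then show "\<exists>V. openin X V \<and> x \<in> V \<and> X closure_of V \<subseteq> U"
    using assms by (intro closure_of_subset_regular_openin[of S]) (auto simp: open_shifts_def)
qed

end
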